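(* Fix $\delta,\beta\in(0,1)$, $K\ge1$, $\eta\ge0$, and suppose that $0\le\rho<\delta$. Assume that $\mathbb{P}$ is supported on $[a,b]\subset\mathbb{R}$ and has a density $f$ satisfying $\inf_{x\in[a,b]}f(x)\ge m>0$, and define $$r_K(\beta)=\frac1m\sqrt{\frac{\ln(2/\beta)}{2K}}.$$ Let $R^{(1)},\ldots,R^{(K)}$ be i.i.d. with distribution $\mathbb{P}$ and let $R^{(0)}$ be an independent random variable with distribution $\mathbb{P}_{\mathrm{test}}$, where $\mathrm{LP}_\eta(\mathbb{P},\mathbb{P}_{\mathrm{test}})\le\rho$. Define $$\bar\alpha_{\mathrm{LP\text{-}DRO}}^{\mathrm{test}}:=\mathrm{Quantile}_{1-\delta+\rho}(R^{(1)},\ldots,R^{(K)})+r_K(\beta)+\eta.$$ Then $$\mathbb{P}^K\Bigl(\mathbb{P}_{\mathrm{test}}\bigl(R^{(0)}\le\bar\alpha_{\mathrm{LP\text{-}DRO}}^{\mathrm{test}}\bigr)\ge1-\delta\Bigr)\ge1-\beta,$$ where the inner probability is over $R^{(0)}\sim\mathbb{P}_{\mathrm{test}}$ with the calibration samples fixed and the outer one is over $R^{(1)},\ldots,R^{(K)}$. Moreover, for every realization of the calibration sample, $$\inf_{\mathbb{Q}\in\mathcal{B}_{r_K(\beta)+\eta,\rho}(\widehat{\mathbb{P}}_K)}\mathbb{Q}\bigl(R^{(0)}\le\bar\alpha_{\mathrm{LP\text{-}DRO}}^{\mathrm{test}}\bigr)\ge1-\delta.$$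
   Context: $\mathcal{X}\subseteq\mathbb{R}$ with its Borel $\sigma$-algebra; $\mathcal{P}(\mathcal{X})$ is the set of Borel probability measures on $\mathcal{X}$, and $\mathbb{P},\mathbb{P}_{\mathrm{test}}\in\mathcal{P}(\mathcal{X})$. $\mathbb{P}^K=\mathbb{P}^{\otimes K}$. For values $a_1,\ldots,a_n$ and $p\in(0,1)$, $\mathrm{Quantile}_p(a_1,\ldots,a_n)$ is the $\lceil np\rceil$-th smallest of them. $\widehat{\mathbb{P}}_K=\frac1K\sum_{i=1}^K\delta_{R^{(i)}}$ is the empirical distribution. For $\epsilon\ge0$, $$\mathrm{LP}_\epsilon(\mathbb{P}_1,\mathbb{P}_2):=\inf_{\pi\in\Gamma(\mathbb{P}_1,\mathbb{P}_2)}\int_{\mathcal{X}\times\mathcal{X}}\mathbf{1}\{|x_1-x_2|>\epsilon\}\,d\pi(x_1,x_2),$$ where $\Gamma(\mathbb{P}_1,\mathbb{P}_2)$ is the set of couplings of $\mathbb{P}_1$ and $\mathbb{P}_2$. The L\'evy--Prokhorov ambiguity set is $\mathcal{B}_{\epsilon,\rho}(\mathbb{P}_1):=\{\mathbb{Q}\in\mathcal{P}(\mathcal{X}):\mathrm{LP}_\epsilon(\mathbb{P}_1,\mathbb{Q})\le\rho\}$. For $\mathbb{Q}\in\mathcal{P}(\mathcal{X})$ and a number $c$, $\mathbb{Q}(R^{(0)}\le c)$ means the $\mathbb{Q}$-mass of $(-\infty,c]$, with the calibration sample held fixed. *)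

theory Defs
  imports "HOL-Probability.Probability"
begin

text \<open>
  The Borel \<open>\<sigma>\<close>-algebra of a subset \<open>X\<close> of the line is
  \<^term>\<open>restrict_space borel X\<close>; \<open>X\<close> itself need not be a Borel set.
\<close>

definition borel_probs :: "real set \<Rightarrow> real measure set" where
  "borel_probs X = space (prob_algebra (restrict_space borel X))"

lemma borel_probs_iff:
  "M \<in> borel_probs X \<longleftrightarrow> sets M = sets (restrict_space borel X) \<and> prob_space M"
  by (auto simp: borel_probs_def space_prob_algebra)

definition couplings :: "real measure \<Rightarrow> real measure \<Rightarrow> (real \<times> real) measure set" where
  "couplings M N =
     {\<pi> \<in> space (prob_algebra (M \<Otimes>\<^sub>M N)). distr \<pi> M fst = M \<and> distr \<pi> N snd = N}"

text \<open>
  For probability measures the set of couplings contains the product measure, so the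
  infimum is taken over a nonempty set of reals that is bounded below by 0.
\<close>

lemma pair_measure_in_couplings:
  assumes "prob_space M" "prob_space N"
  shows "M \<Otimes>\<^sub>M N \<in> couplings M N"
proof -
  interpret M: prob_space M by fact
  interpret N: prob_space N by fact
  interpret MN: pair_prob_space M N ..
  have "distr (M \<Otimes>\<^sub>M N) M fst = M"
    by (rule N.distr_pair_fst)
  moreover have "distr (M \<Otimes>\<^sub>M N) N snd = N"
  proof (rule measure_eqI)
    fix A assume "A \<in> sets (distr (M \<Otimes>\<^sub>M N) N snd)"
    then have A: "A \<in> sets N" by simp
    have "snd -` A \<inter> space (M \<Otimes>\<^sub>M N) = space M \<times> A"
      using sets.sets_into_space[OF A] by (auto simp: space_pair_measure)
    then show "emeasure (distr (M \<Otimes>\<^sub>M N) N snd) A = emeasure N A"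
      using A by (simp add: emeasure_distr N.emeasure_pair_measure_Times M.emeasure_space_1)
  qed simp
  ultimately show ?thesis
    using MN.prob_space_axioms by (simp add: couplings_def space_prob_algebra)
qed

definition LP :: "real \<Rightarrow> real measure \<Rightarrow> real measure \<Rightarrow> real" where
  "LP \<epsilon> M N =
     (INF \<pi> \<in> couplings M N. \<integral>z. indicator {(x, y). \<bar>x - y\<bar> > \<epsilon>} z \<partial>\<pi>)"

definition LP_ball :: "real set \<Rightarrow> real \<Rightarrow> real \<Rightarrow> real measure \<Rightarrow> real measure set" where
  "LP_ball X \<epsilon> \<rho> M = {Q \<in> borel_probs X. LP \<epsilon> M Q \<le> \<rho>}"

text \<open>
  A sample of size \<open>K\<close> is a function \<open>R\<close> of which only the values at \<open>1, \<dots>, K\<close> matter.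
  The following lemma confirms that \<^term>\<open>measure_of\<close> is applied to a measure.
\<close>

definition empirical :: "real set \<Rightarrow> nat \<Rightarrow> (nat \<Rightarrow> real) \<Rightarrow> real measure" where
  "empirical X K R =
     measure_of X (sets (restrict_space borel X))
       (\<lambda>A. (\<Sum>i=1..K. emeasure (return (restrict_space borel X) (R i)) A) / of_nat K)"

lemma sets_empirical: "sets (empirical X K R) = sets (restrict_space borel X)"
  using sets.space_closed[of "restrict_space borel X"]
    sets.sigma_sets_eq[of "restrict_space borel X"]
  by (simp add: empirical_def space_restrict_space)

lemma emeasure_empirical:
  assumes "A \<in> sets (restrict_space borel X)"
  shows "emeasure (empirical X K R) A =
     (\<Sum>i=1..K. emeasure (return (restrict_space borel X) (R i)) A) / of_nat K"
proof (rule emeasure_measure_of[OF empirical_def])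
  let ?B = "restrict_space borel X :: real measure"
  let ?d = "\<lambda>i. return ?B (R i)"
  let ?\<mu> = "\<lambda>A. (\<Sum>i=1..K. emeasure (?d i) A) / of_nat K"
  show "sets ?B \<subseteq> Pow X"
    using sets.space_closed[of ?B] by (simp add: space_restrict_space)
  show "A \<in> sets (empirical X K R)"
    using assms by (simp add: sets_empirical)
  show "positive (sets (empirical X K R)) ?\<mu>"
    by (simp add: positive_def)
  show "countably_additive (sets (empirical X K R)) ?\<mu>"
  proof (rule countably_additiveI)
    fix F :: "nat \<Rightarrow> real set"
    assume F: "range F \<subseteq> sets (empirical X K R)" "disjoint_family F"
    have "(\<Sum>n. ?\<mu> (F n)) = (\<Sum>n. \<Sum>i=1..K. emeasure (?d i) (F n)) / of_nat K"
      by (simp add: divide_ennreal_def)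
    also have "(\<Sum>n. \<Sum>i=1..K. emeasure (?d i) (F n)) = (\<Sum>i=1..K. \<Sum>n. emeasure (?d i) (F n))"
      by (rule suminf_sum) simp
    also have "\<dots> = (\<Sum>i=1..K. emeasure (?d i) (\<Union>n. F n))"
      using F by (intro sum.cong refl suminf_emeasure) (simp_all add: sets_empirical)
    finally show "(\<Sum>n. ?\<mu> (F n)) = ?\<mu> (\<Union>n. F n)" .
  qed
qed

text \<open>
  The \<open>\<lceil>n p\<rceil>\<close>-th smallest value has index \<open>\<lceil>n p\<rceil> - 1\<close> in the sorted list, as lists are
  indexed from 0. It is in range for nonempty lists and \<open>0 < p < 1\<close>.
\<close>

definition quantile :: "real \<Rightarrow> real list \<Rightarrow> real" where
  "quantile p as = sort as ! (nat \<lceil>real (length as) * p\<rceil> - 1)"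

definition DKW_radius :: "real \<Rightarrow> nat \<Rightarrow> real \<Rightarrow> real" where
  "DKW_radius m K \<beta> = 1 / m * sqrt (ln (2 / \<beta>) / (2 * real K))"

definition alpha_LP_DRO ::
    "real \<Rightarrow> real \<Rightarrow> real \<Rightarrow> real \<Rightarrow> real \<Rightarrow> nat \<Rightarrow> (nat \<Rightarrow> real) \<Rightarrow> real" where
  "alpha_LP_DRO \<delta> \<rho> \<eta> m \<beta> K R =
     quantile (1 - \<delta> + \<rho>) (map R [1..<Suc K]) + DKW_radius m K \<beta> + \<eta>"

end

theory Submission
  imports Defs
begin

text \<open>
  A coupling of \<open>M\<close> and \<open>N\<close> under which the coordinates differ by more than \<open>\<epsilon>\<close> with
  probability at most \<open>\<rho>\<close> shows that shifting a threshold by \<open>\<epsilon>\<close> costs at most \<open>\<rho>\<close> in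
  probability: \<open>N(x \<le> c + \<epsilon>) \<ge> M(x \<le> c) - \<rho>\<close> (\<open>LP_transfer\<close>). Write \<open>p = 1 - \<delta> + \<rho>\<close> for the
  level of the quantile. Both claims then reduce to finding a threshold that has mass at least
  \<open>p\<close> under the reference measure.

  For the worst case over the ambiguity set, the reference measure is the empirical one. At
  least \<open>K p\<close> of the \<open>K\<close> sample points are at most the sample quantile, so its empirical mass is
  at least \<open>p\<close>, and transfer with shift \<open>r + \<eta>\<close> leaves \<open>p - \<rho> = 1 - \<delta>\<close>.

  For the sampling guarantee, the reference measure is \<open>P\<close> and the threshold is the sample
  quantile plus the radius \<open>r\<close>. Let \<open>q\<close> be a point with \<open>P(x \<le> q) = p\<close>. The threshold has
  enough mass unless the sample quantile falls to \<open>q - r\<close> or below, which means that the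
  empirical distribution function at the fixed point \<open>q - r\<close> reaches \<open>p\<close>. If \<open>q - r < a\<close>, this
  has probability zero. Otherwise the lower bound on the density gives
  \<open>P(x \<le> q - r) \<le> p - m r\<close>, so it is an upward deviation by \<open>m r\<close> at a single point, and
  Hoeffding's inequality bounds its probability by \<open>exp (- 2 K (m r)\<^sup>2)\<close>, which is \<open>\<beta> / 2\<close> for
  the given radius (\<open>sample_quantile_upper_confidence\<close>).
\<close>

section \<open>Empirical quantiles\<close>

text \<open>
  The indices of a sorted list whose entries are at most \<open>t\<close> form an initial segment, so
  membership of \<open>k\<close> in it is decided by its length.
\<close>

lemma sorted_nth_le_iff:
  fixes xs :: "'a :: linorder list"
  assumes "sorted xs" and "k < length xs"
  shows "xs ! k \<le> t \<longleftrightarrow> k < length (filter (\<lambda>x. x \<le> t) xs)"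
proof
  assume "xs ! k \<le> t"
  then have "{..k} \<subseteq> {i. i < length xs \<and> xs ! i \<le> t}"
    using assms by (auto intro: order_trans[OF sorted_nth_mono])
  then have "card {..k} \<le> card {i. i < length xs \<and> xs ! i \<le> t}"
    by (intro card_mono) auto
  then show "k < length (filter (\<lambda>x. x \<le> t) xs)"
    by (simp add: length_filter_conv_card)
next
  assume *: "k < length (filter (\<lambda>x. x \<le> t) xs)"
  show "xs ! k \<le> t"
  proof (rule ccontr)
    assume "\<not> xs ! k \<le> t"
    then have "{i. i < length xs \<and> xs ! i \<le> t} \<subseteq> {..<k}"
      using sorted_nth_mono[OF assms(1), of k] by (force simp: not_le)
    then have "card {i. i < length xs \<and> xs ! i \<le> t} \<le> card {..<k}"
      by (intro card_mono) auto
    then show False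
      using * by (simp add: length_filter_conv_card)
  qed
qed

text \<open>
  This Galois-type relation turns every statement about quantiles into one about counts, which
  are sums of indicators. The rounding in the definition disappears because counts are integers.
\<close>

lemma quantile_le_iff:
  assumes "xs \<noteq> []" and "0 < p" and "p \<le> 1"
  shows "quantile p xs \<le> t \<longleftrightarrow> real (length xs) * p \<le> real (length (filter (\<lambda>x. x \<le> t) xs))"
proof -
  let ?k = "nat \<lceil>real (length xs) * p\<rceil>"
  have pos: "0 < real (length xs) * p"
    using assms by simp
  have "real (length xs) * p \<le> real (length xs)"
    using assms by (simp add: mult_left_le)
  then have k: "0 < ?k" "?k \<le> length xs"
    using pos by linarith+
  have "quantile p xs \<le> t \<longleftrightarrow> ?k - 1 < length (filter (\<lambda>x. x \<le> t) (sort xs))"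
    unfolding quantile_def using k by (intro sorted_nth_le_iff) (simp_all, linarith)
  also have "length (filter (\<lambda>x. x \<le> t) (sort xs)) = length (filter (\<lambda>x. x \<le> t) xs)"
    by (metis filter_sort length_sort)
  also have "?k - 1 < length (filter (\<lambda>x. x \<le> t) xs)
      \<longleftrightarrow> real (length xs) * p \<le> real (length (filter (\<lambda>x. x \<le> t) xs))"
    using k by linarith
  finally show ?thesis .
qed

lemma length_filter_sample:
  "real (length (filter (\<lambda>x. x \<le> t) (map R [1..<Suc K]))) = (\<Sum>i=1..K. indicator {..t} (R i))"
  by (induction K) (auto simp: indicator_def)

lemma sample_quantile_le_iff:
  assumes "K \<ge> 1" and "0 < p" and "p \<le> 1"
  shows "quantile p (map R [1..<Suc K]) \<le> t \<longleftrightarrow> real K * p \<le> (\<Sum>i=1..K. indicator {..t} (R i))"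
  unfolding length_filter_sample[symmetric]
  using assms quantile_le_iff[of "map R [1..<Suc K]" p t]
  by (simp del: upt_Suc filter_map)

lemma borel_measurable_sample_quantile:
  assumes [measurable]: "(\<lambda>x. x) \<in> borel_measurable M" and "K \<ge> 1" and "0 < p" and "p \<le> 1"
  shows "(\<lambda>R. quantile p (map R [1..<Suc K])) \<in> borel_measurable (Pi\<^sub>M {1..K} (\<lambda>_. M))"
proof (subst borel_measurable_iff_le, intro allI)
  fix t :: real
  have [measurable]: "(\<lambda>R. R i) \<in> borel_measurable (Pi\<^sub>M {1..K} (\<lambda>_. M))" if "i \<in> {1..K}" for i
    using measurable_compose[OF measurable_component_singleton[OF that] assms(1)] .
  show "{R \<in> space (Pi\<^sub>M {1..K} (\<lambda>_. M)). quantile p (map R [1..<Suc K]) \<le> t} \<in> sets (Pi\<^sub>M {1..K} (\<lambda>_. M))"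
    unfolding sample_quantile_le_iff[OF assms(2-4)] by measurable
qed

section \<open>Thresholds and couplings\<close>

lemma id_borel_measurable:
  assumes "sets M = sets (restrict_space borel X)"
  shows "(\<lambda>x. x) \<in> borel_measurable M"
  using measurable_restrict_space1[OF measurable_ident_sets[OF refl], of borel X]
    measurable_cong_sets[OF assms refl] by blast

text \<open>
  If the first coordinate is at most \<open>c\<close>, then the second is at most \<open>c + \<epsilon>\<close> unless the two
  differ by more than \<open>\<epsilon>\<close>. Taking probabilities under an arbitrary coupling bounds the loss of
  mass by the cost of that coupling, hence by the infimum over all couplings.
\<close>

lemma LP_transfer:
  assumes M: "prob_space M" "(\<lambda>x. x) \<in> borel_measurable M"
    and N: "prob_space N" "(\<lambda>x. x) \<in> borel_measurable N"
    and LP: "LP \<epsilon> M N \<le> \<rho>"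
  shows "\<P>(x in N. x \<le> c + \<epsilon>) \<ge> \<P>(x in M. x \<le> c) - \<rho>"
proof -
  note [measurable] = M(2) N(2)
  have "\<P>(x in M. x \<le> c) - \<P>(x in N. x \<le> c + \<epsilon>) \<le> LP \<epsilon> M N"
    unfolding LP_def
  proof (rule cINF_greatest)
    show "couplings M N \<noteq> {}"
      using pair_measure_in_couplings[OF M(1) N(1)] by blast
  next
    fix \<pi> assume \<pi>: "\<pi> \<in> couplings M N"
    then have sets_\<pi> [measurable_cong]: "sets \<pi> = sets (M \<Otimes>\<^sub>M N)" and "prob_space \<pi>"
      and fst: "distr \<pi> M fst = M" and snd: "distr \<pi> N snd = N"
      by (auto simp: couplings_def space_prob_algebra)
    interpret \<pi>: prob_space \<pi> by fact
    have [measurable]: "fst \<in> borel_measurable \<pi>" "snd \<in> borel_measurable \<pi>"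
      using measurable_compose[OF measurable_fst M(2)] measurable_compose[OF measurable_snd N(2)]
      by (simp_all add: measurable_cong_sets[OF sets_\<pi> refl])
    have sp: "z \<in> space \<pi> \<Longrightarrow> fst z \<in> space M \<and> snd z \<in> space N" for z
      by (simp add: sets_eq_imp_space_eq[OF sets_\<pi>] space_pair_measure mem_Times_iff)
    have "measure M {x \<in> space M. x \<le> c} = measure (distr \<pi> M fst) {x \<in> space M. x \<le> c}"
      by (simp add: fst)
    also have "\<dots> = \<P>(z in \<pi>. fst z \<le> c)"
      by (subst measure_distr) (auto intro!: arg_cong[where f = "measure \<pi>"] dest: sp)
    also have "\<dots> \<le> measure \<pi> ({z \<in> space \<pi>. snd z \<le> c + \<epsilon>} \<union> {z \<in> space \<pi>. \<bar>fst z - snd z\<bar> > \<epsilon>})"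
      by (intro \<pi>.finite_measure_mono) auto
    also have "\<dots> \<le> \<P>(z in \<pi>. snd z \<le> c + \<epsilon>) + \<P>(z in \<pi>. \<bar>fst z - snd z\<bar> > \<epsilon>)"
      by (intro measure_Un_le) auto
    also have "\<P>(z in \<pi>. snd z \<le> c + \<epsilon>) = measure (distr \<pi> N snd) {x \<in> space N. x \<le> c + \<epsilon>}"
      by (subst measure_distr) (auto intro!: arg_cong[where f = "measure \<pi>"] dest: sp)
    also have "\<dots> = \<P>(x in N. x \<le> c + \<epsilon>)"
      by (simp add: snd)
    also have "\<P>(z in \<pi>. \<bar>fst z - snd z\<bar> > \<epsilon>)
        = (\<integral>z. indicator {z \<in> space \<pi>. \<bar>fst z - snd z\<bar> > \<epsilon>} z \<partial>\<pi>)"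
      by simp
    also have "\<dots> = (\<integral>z. indicator {(x, y). \<bar>x - y\<bar> > \<epsilon>} z \<partial>\<pi>)"
      by (intro Bochner_Integration.integral_cong) (auto simp: indicator_def)
    finally show "\<P>(x in M. x \<le> c) - \<P>(x in N. x \<le> c + \<epsilon>)
        \<le> (\<integral>z. indicator {(x, y). \<bar>x - y\<bar> > \<epsilon>} z \<partial>\<pi>)"
      by simp
  qed
  with LP show ?thesis by simp
qed

text \<open>
  The diagonal coupling has cost zero. This makes the ambiguity ball nonempty; without it, the
  infimum over the ball would be an unspecified real number.
\<close>

lemma LP_refl:
  assumes "prob_space M" and [measurable]: "(\<lambda>x. x) \<in> borel_measurable M" and "0 \<le> \<epsilon>"
  shows "LP \<epsilon> M M \<le> 0"
proof -
  interpret M: prob_space M by fact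
  let ?D = "distr M (M \<Otimes>\<^sub>M M) (\<lambda>x. (x, x))"
  have "?D \<in> couplings M M"
    by (auto simp: couplings_def space_prob_algebra distr_distr comp_def distr_id
        intro!: M.prob_space_distr)
  moreover have "(\<integral>z. indicator {(x, y). \<bar>x - y\<bar> > \<epsilon>} z \<partial>?D) = (0 :: real)"
  proof (rule integral_eq_zero_AE)
    have [measurable]: "fst \<in> borel_measurable (M \<Otimes>\<^sub>M M)" "snd \<in> borel_measurable (M \<Otimes>\<^sub>M M)"
      using measurable_compose[OF measurable_fst assms(2)] measurable_compose[OF measurable_snd assms(2)]
      by simp_all
    have "AE z in ?D. \<not> \<bar>fst z - snd z\<bar> > \<epsilon>"
      using \<open>0 \<le> \<epsilon>\<close> by (subst AE_distr_iff) auto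
    then show "AE z in ?D. indicator {(x, y). \<bar>x - y\<bar> > \<epsilon>} z = (0 :: real)"
      by eventually_elim (auto simp: indicator_def)
  qed
  moreover have "bdd_below ((\<lambda>\<pi>. \<integral>z. indicator {(x, y). \<bar>x - y\<bar> > \<epsilon>} z \<partial>\<pi> :: real) ` couplings M M)"
    by (intro bdd_belowI2[where m = 0] integral_nonneg_AE) auto
  ultimately show ?thesis
    unfolding LP_def by (metis (no_types, lifting) cINF_lower)
qed

section \<open>The empirical measure\<close>

lemma empirical_in_borel_probs:
  assumes "K \<ge> 1" and "\<And>i. i \<in> {1..K} \<Longrightarrow> R i \<in> X"
  shows "empirical X K R \<in> borel_probs X"
proof -
  have X: "X \<in> sets (restrict_space borel X)"
    using sets.top[of "restrict_space borel X"] by (simp add: space_restrict_space)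
  have "space (empirical X K R) = X"
    using sets_eq_imp_space_eq[OF sets_empirical[of X K R]] by (simp add: space_restrict_space)
  moreover have "(\<Sum>i=1..K. emeasure (return (restrict_space borel X) (R i)) X) = (\<Sum>i=1..K. 1)"
    using assms X by (intro sum.cong) (auto simp: indicator_def)
  ultimately have "emeasure (empirical X K R) (space (empirical X K R)) = 1"
    using assms X by (simp add: emeasure_empirical ennreal_of_nat_eq_real_of_nat divide_ennreal)
  then show ?thesis
    by (auto simp: borel_probs_iff sets_empirical intro: prob_spaceI)
qed

lemma measure_empirical_atMost:
  assumes "K \<ge> 1" and "\<And>i. i \<in> {1..K} \<Longrightarrow> R i \<in> X"
  shows "\<P>(x in empirical X K R. x \<le> t) = (\<Sum>i=1..K. indicator {..t} (R i)) / real K"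
proof -
  have sp: "space (empirical X K R) = X"
    using sets_eq_imp_space_eq[OF sets_empirical[of X K R]] by (simp add: space_restrict_space)
  have A: "{x \<in> X. x \<le> t} \<in> sets (restrict_space borel X)"
    by (auto simp: sets_restrict_space intro!: image_eqI[where x = "{..t}"])
  have "emeasure (return (restrict_space borel X) (R i)) {x \<in> X. x \<le> t} = ennreal (indicator {..t} (R i))"
    if "i \<in> {1..K}" for i
    using assms(2)[OF that] A by (simp add: indicator_def)
  then have "emeasure (empirical X K R) {x \<in> X. x \<le> t}
      = (\<Sum>i=1..K. ennreal (indicator {..t} (R i))) / of_nat K"
    by (simp only: emeasure_empirical[OF A] cong: sum.cong)
  also have "\<dots> = ennreal ((\<Sum>i=1..K. indicator {..t} (R i)) / real K)"
    using assms(1) by (simp add: sum_ennreal sum_nonneg ennreal_of_nat_eq_real_of_nat divide_ennreal)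
  finally show ?thesis
    by (simp add: sp measure_def sum_nonneg)
qed

section \<open>Concentration of the empirical distribution function\<close>

text \<open>
  Hoeffding's inequality for the number of sample points up to a fixed \<open>t\<close>, a sum of
  independent indicators with mean \<open>P(x \<le> t)\<close>.
\<close>

lemma empirical_cdf_upper_tail:
  fixes P :: "real measure"
  assumes "prob_space P" and P [measurable]: "(\<lambda>x. x) \<in> borel_measurable P"
    and "K \<ge> 1" and "0 \<le> s"
  shows "\<P>(R in Pi\<^sub>M {1..K} (\<lambda>_. P).
            real K * (\<P>(x in P. x \<le> t) + s) \<le> (\<Sum>i=1..K. indicator {..t} (R i)))
         \<le> exp (- 2 * real K * s\<^sup>2)"
proof -
  interpret P: prob_space P by fact
  let ?M = "Pi\<^sub>M {1..K} (\<lambda>_. P)"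
  interpret M: prob_space ?M by (intro prob_space_PiM P.prob_space_axioms)
  let ?Y = "\<lambda>i R. indicator {..t} (R i) :: real"
  have "M.indep_vars (\<lambda>_. P) (\<lambda>i R. R i) {1..K}"
  proof (subst M.indep_vars_iff_distr_eq_PiM')
    have "distr ?M ?M (\<lambda>R. \<lambda>i\<in>{1..K}. R i) = distr ?M ?M (\<lambda>R. R)"
      by (intro distr_cong) (auto simp: space_PiM)
    also have "\<dots> = ?M"
      by (rule distr_id)
    also have "\<dots> = Pi\<^sub>M {1..K} (\<lambda>i. distr ?M P (\<lambda>R. R i))"
      by (intro PiM_cong refl distr_PiM_component[symmetric] P.prob_space_axioms)
    finally show "distr ?M ?M (\<lambda>R. \<lambda>i\<in>{1..K}. R i) = Pi\<^sub>M {1..K} (\<lambda>i. distr ?M P (\<lambda>R. R i))" .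
  qed (use \<open>K \<ge> 1\<close> in auto)
  moreover have "indicat_real {..t} \<in> borel_measurable P"
    by (rule measurable_compose[OF P]) (rule borel_measurable_indicator, simp)
  ultimately have indep: "M.indep_vars (\<lambda>_. borel) ?Y {1..K}"
    by (rule M.indep_vars_compose2)
  interpret H: Hoeffding_ineq ?M "{1..K}" ?Y "\<lambda>_. 0" "\<lambda>_. 1" "\<Sum>i=1..K. M.expectation (?Y i)"
  proof unfold_locales
    show "AE R in ?M. ?Y i R \<in> {0..1}" for i
      by simp
  qed (use indep in simp_all)
  have E: "M.expectation (?Y i) = \<P>(x in P. x \<le> t)" if i: "i \<in> {1..K}" for i
  proof -
    have "M.expectation (?Y i) = (\<integral>x. indicator {..t} x \<partial>distr ?M P (\<lambda>R. R i))"
      using i by (subst integral_distr) auto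
    also have "\<dots> = (\<integral>x. indicator {..t} x \<partial>P)"
      using distr_PiM_component[of "{1..K}" "\<lambda>_. P", OF P.prob_space_axioms i] by (rule arg_cong)
    also have "\<dots> = (\<integral>x. indicator {x \<in> space P. x \<le> t} x \<partial>P)"
      by (intro Bochner_Integration.integral_cong) (auto simp: indicator_def)
    finally show ?thesis by simp
  qed
  have mean: "(\<Sum>i=1..K. M.expectation (?Y i)) = real K * \<P>(x in P. x \<le> t)"
    by (subst sum.cong[OF refl E]) simp_all
  have "\<P>(R in ?M. real K * (\<P>(x in P. x \<le> t) + s) \<le> (\<Sum>i=1..K. ?Y i R))
      \<le> exp (- 2 * (real K * s)\<^sup>2 / (\<Sum>i=1..K. (1 - 0)\<^sup>2))"
    unfolding distrib_left mean[symmetric] using assms(3,4) by (intro H.Hoeffding_ineq_ge) simp_all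
  also have "- 2 * (real K * s)\<^sup>2 / (\<Sum>i=1..K. (1 - 0)\<^sup>2) = - 2 * real K * s\<^sup>2"
    using \<open>K \<ge> 1\<close> by (simp add: power2_eq_square)
  finally show ?thesis by simp
qed

section \<open>Distribution functions of densities\<close>

lemma cdf_density_diff_ge:
  assumes "real_distribution (density lborel f)" and [measurable]: "f \<in> borel_measurable lborel"
    and lower: "\<And>x. x \<in> {a..b} \<Longrightarrow> ennreal m \<le> f x" and "0 \<le> m"
    and "a \<le> s" and "s \<le> u" and "u \<le> b"
  shows "m * (u - s) \<le> cdf (density lborel f) u - cdf (density lborel f) s"
proof (cases "s = u")
  case False
  with \<open>s \<le> u\<close> have "s < u" by simp
  interpret real_distribution "density lborel f" by fact
  have "ennreal (m * (u - s)) = (\<integral>\<^sup>+x. ennreal m * indicator {s<..u} x \<partial>lborel)"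
    using \<open>s \<le> u\<close> \<open>0 \<le> m\<close> by (simp add: nn_integral_cmult_indicator ennreal_mult)
  also have "\<dots> \<le> (\<integral>\<^sup>+x. f x * indicator {s<..u} x \<partial>lborel)"
    using assms by (intro nn_integral_mono) (auto simp: indicator_def)
  also have "\<dots> = ennreal (measure (density lborel f) {s<..u})"
    by (simp add: emeasure_density flip: emeasure_eq_measure)
  finally show ?thesis
    using \<open>s < u\<close> by (simp add: cdf_diff_eq)
qed simp

text \<open>
  A distribution with a density has no atoms, so its distribution function is continuous. If
  it is concentrated on \<open>[a, b]\<close>, this function vanishes at \<open>a\<close>, equals 1 at \<open>b\<close>, and takes every value between by the intermediate value
  theorem.
\<close>

lemma cdf_density_attains:
  assumes "real_distribution (density lborel f)" and [measurable]: "f \<in> borel_measurable lborel"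
    and AE: "AE x in density lborel f. x \<in> {a..b}" and "0 \<le> p" and "p \<le> 1"
  obtains q where "a \<le> q" and "q \<le> b" and "cdf (density lborel f) q = p"
proof -
  let ?D = "density lborel f"
  interpret real_distribution ?D by fact
  have point: "measure ?D {x} = 0" for x
  proof -
    have "emeasure ?D {x} = 0"
      by (subst emeasure_density) (auto simp: nn_integral_0_iff_AE intro!: AE_I'[of "{x}"])
    then show ?thesis by (simp add: measure_def)
  qed
  have "a \<le> b"
  proof (rule ccontr)
    assume "\<not> a \<le> b"
    then have "AE x in ?D. False" using AE by auto
    then show False using AE_False by simp
  qed
  have "AE x in ?D. x \<noteq> a"
    using point[of a] by (intro AE_I'[of "{a}"]) (auto simp: null_sets_def emeasure_eq_measure)
  with AE have "AE x in ?D. x \<notin> {..a}"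
    by eventually_elim auto
  then have "cdf ?D a = 0"
    by (subst cdf_def, subst prob_eq_0) auto
  moreover have "cdf ?D b = 1"
    using AE unfolding cdf_def by (subst prob_eq_1) auto
  moreover have "continuous_on {a..b} (cdf ?D)"
    by (auto intro!: continuous_at_imp_continuous_on simp: isCont_cdf point)
  ultimately show ?thesis
    using IVT'[of "cdf ?D" a p b] \<open>a \<le> b\<close> assms that by auto
qed

section \<open>Confidence of the sample quantile\<close>

text \<open>
  Moving the sample quantile up by \<open>r\<close> takes it past the true quantile \<open>q\<close> unless at least
  \<open>K p\<close> sample points are at most \<open>q - r\<close>. On \<open>[a, b]\<close> the slope of the distribution
  function is at least \<open>m\<close>, so this is an excess of \<open>m r\<close> over the expected fraction. Left of
  \<open>a\<close> the slope bound is not available, but there almost surely no sample point occurs.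
\<close>

lemma sample_quantile_upper_confidence:
  assumes "prob_space P" and dens: "distributed P lborel (\<lambda>x. x) f"
    and AE: "AE x in P. x \<in> {a..b}" and lower: "\<And>x. x \<in> {a..b} \<Longrightarrow> ennreal m \<le> f x"
    and "0 \<le> m" and "0 \<le> r" and "K \<ge> 1" and "0 < p" and "p \<le> 1"
  shows "\<P>(R in Pi\<^sub>M {1..K} (\<lambda>_. P).
            \<P>(x in P. x \<le> quantile p (map R [1..<Suc K]) + r) \<ge> p)
         \<ge> 1 - exp (- 2 * real K * (m * r)\<^sup>2)"
proof -
  interpret P: prob_space P by fact
  let ?M = "Pi\<^sub>M {1..K} (\<lambda>_. P)"
  interpret M: prob_space ?M by (intro prob_space_PiM P.prob_space_axioms)
  let ?D = "density lborel f"
  have P [measurable]: "(\<lambda>x. x) \<in> borel_measurable P"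
    and f [measurable]: "f \<in> borel_measurable lborel" and D: "distr P lborel (\<lambda>x. x) = ?D"
    using dens by (auto simp: distributed_def)
  have comp [measurable]: "(\<lambda>R. R i) \<in> borel_measurable ?M" if "i \<in> {1..K}" for i
    using measurable_compose[OF measurable_component_singleton[OF that] P] .
  have rd: "real_distribution ?D"
    unfolding D[symmetric] by (auto simp: real_distribution_def real_distribution_axioms_def intro!: P.prob_space_distr)
  have cdf: "\<P>(x in P. x \<le> t) = cdf ?D t" for t
    unfolding D[symmetric] cdf_def
    by (subst measure_distr) (auto intro!: arg_cong[where f = "measure P"])
  have mono: "\<P>(x in P. x \<le> s) \<le> \<P>(x in P. x \<le> u)" if "s \<le> u" for s u
    using that by (intro P.finite_measure_mono) auto
  have "AE x in ?D. x \<in> {a..b}"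
    unfolding D[symmetric] using AE by (subst AE_distr_iff) auto
  from cdf_density_attains[OF rd f this less_imp_le[OF \<open>0 < p\<close>] \<open>p \<le> 1\<close>]
  obtain q where q: "a \<le> q" "q \<le> b" "\<P>(x in P. x \<le> q) = p"
    unfolding cdf by blast
  \<comment> \<open>\<open>B\<close> also contains the harmless samples whose quantile is exactly \<open>q - r\<close>; in return it is
    a deviation event at the fixed point \<open>t\<close>.\<close>
  define t where "t = q - r"
  define B where "B = {R \<in> space ?M. real K * p \<le> (\<Sum>i=1..K. indicator {..t} (R i))}"
  define G where "G = {R \<in> space ?M. p \<le> \<P>(x in P. x \<le> quantile p (map R [1..<Suc K]) + r)}"
  have B [measurable]: "B \<in> sets ?M"
    unfolding B_def by measurable
  \<comment> \<open>The inner probability depends on the sample through the quantile only, and monotonically.\<close>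
  have [measurable]: "(\<lambda>c. \<P>(x in P. x \<le> c)) \<in> borel_measurable borel"
    by (intro borel_measurable_mono monoI mono)
  note [measurable] = borel_measurable_sample_quantile[OF P \<open>K \<ge> 1\<close> \<open>0 < p\<close> \<open>p \<le> 1\<close>]
  have G [measurable]: "G \<in> sets ?M"
    unfolding G_def by measurable
  have "space ?M - B \<subseteq> G"
  proof
    fix R assume R: "R \<in> space ?M - B"
    then have "\<not> quantile p (map R [1..<Suc K]) \<le> t"
      using assms by (subst sample_quantile_le_iff) (auto simp: B_def)
    then have "\<P>(x in P. x \<le> q) \<le> \<P>(x in P. x \<le> quantile p (map R [1..<Suc K]) + r)"
      by (intro mono) (simp add: t_def)
    with q R show "R \<in> G" by (simp add: G_def)
  qed
  then have "1 - measure ?M B \<le> measure ?M G"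
    using M.finite_measure_mono[OF _ G, of "space ?M - B"] M.prob_compl[OF B] by simp
  moreover have "measure ?M B \<le> exp (- 2 * real K * (m * r)\<^sup>2)"
  proof (cases "a \<le> t")
    case True
    have "m * r \<le> p - \<P>(x in P. x \<le> t)"
      using cdf_density_diff_ge[OF rd f lower \<open>0 \<le> m\<close> True _ q(2)] q(3) \<open>0 \<le> r\<close>
      unfolding cdf by (simp add: t_def)
    then have "real K * (\<P>(x in P. x \<le> t) + m * r) \<le> real K * p"
      by (intro mult_left_mono) auto
    then have "measure ?M B \<le> \<P>(R in ?M. real K * (\<P>(x in P. x \<le> t) + m * r)
        \<le> (\<Sum>i=1..K. indicator {..t} (R i)))"
      unfolding B_def by (intro M.finite_measure_mono) auto
    also have "\<dots> \<le> exp (- 2 * real K * (m * r)\<^sup>2)"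
      using assms by (intro empirical_cdf_upper_tail P) auto
    finally show ?thesis .
  next
    case False
    have "AE R in ?M. \<forall>i\<in>{1..K}. R i \<in> {a..b}"
      using AE by (intro AE_finite_allI AE_PiM_component P.prob_space_axioms) auto
    then have "AE R in ?M. R \<notin> B"
    proof eventually_elim
      case (elim R)
      then have "(\<Sum>i=1..K. indicator {..t} (R i)) = (0 :: real)"
        using False by (intro sum.neutral) (auto simp: indicator_def)
      moreover have "0 < real K * p"
        using assms by simp
      ultimately show ?case by (simp add: B_def)
    qed
    then have "measure ?M B = 0"
      using M.prob_eq_0[OF B] by blast
    then show ?thesis by simp
  qed
  ultimately show ?thesis by (simp add: G_def)
qed

section \<open>Coverage of the robust quantile\<close>

theorem theorem5p7:
  fixes X :: "real set" and P Ptest :: "real measure"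
    and f :: "real \<Rightarrow> real" and a b m \<delta> \<beta> \<eta> \<rho> :: real and K :: nat
  assumes "0 < \<delta>" and "\<delta> < 1" and "0 < \<beta>" and "\<beta> < 1"
    and "K \<ge> 1" and "\<eta> \<ge> 0" and "0 \<le> \<rho>" and "\<rho> < \<delta>"
    and "P \<in> borel_probs X" and "Ptest \<in> borel_probs X"
    and "AE x in P. x \<in> {a..b}"
    and "\<And>x. f x \<ge> 0"
    and "distributed P lborel (\<lambda>x. x) (\<lambda>x. ennreal (f x))"
    and "(INF x\<in>{a..b}. f x) \<ge> m" and "m > 0"
    and "LP \<eta> P Ptest \<le> \<rho>"
  shows "\<P>(R in Pi\<^sub>M {1..K} (\<lambda>_. P).
             \<P>(x in Ptest. x \<le> alpha_LP_DRO \<delta> \<rho> \<eta> m \<beta> K R) \<ge> 1 - \<delta>) \<ge> 1 - \<beta>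
       \<and> (\<forall>R \<in> space (Pi\<^sub>M {1..K} (\<lambda>_. P)).
             (INF Q \<in> LP_ball X (DKW_radius m K \<beta> + \<eta>) \<rho> (empirical X K R).
                \<P>(x in Q. x \<le> alpha_LP_DRO \<delta> \<rho> \<eta> m \<beta> K R)) \<ge> 1 - \<delta>)"
proof -
  define p where "p = 1 - \<delta> + \<rho>"
  define r where "r = DKW_radius m K \<beta>"
  let ?M = "Pi\<^sub>M {1..K} (\<lambda>_. P)"
  let ?q = "\<lambda>R. quantile p (map R [1..<Suc K])"
  have alpha: "alpha_LP_DRO \<delta> \<rho> \<eta> m \<beta> K R = ?q R + r + \<eta>" for R
    by (simp add: alpha_LP_DRO_def p_def r_def)
  have p: "0 < p" "p \<le> 1"
    using assms by (auto simp: p_def)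
  have ln: "0 \<le> ln (2 / \<beta>)"
    using assms by simp
  have r: "0 \<le> r"
    using ln assms by (simp add: r_def DKW_radius_def)
  have P: "prob_space P" "sets P = sets (restrict_space borel X)"
    and T: "prob_space Ptest" "sets Ptest = sets (restrict_space borel X)"
    using assms by (auto simp: borel_probs_iff)
  note Pid [measurable] = id_borel_measurable[OF P(2)]
  note Tid [measurable] = id_borel_measurable[OF T(2)]
  interpret P: prob_space P by fact
  interpret T: prob_space Ptest by fact
  interpret M: prob_space ?M by (intro prob_space_PiM P.prob_space_axioms)
  have lower: "ennreal m \<le> ennreal (f x)" if "x \<in> {a..b}" for x
  proof -
    have "(INF x\<in>{a..b}. f x) \<le> f x"
      using that assms by (intro cINF_lower bdd_belowI2[where m = 0]) auto
    then show ?thesis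
      using assms by (intro ennreal_leI) simp
  qed
  have sampling: "1 - \<beta> \<le> \<P>(R in ?M. \<P>(x in Ptest. x \<le> ?q R + r + \<eta>) \<ge> 1 - \<delta>)"
  proof -
    \<comment> \<open>The radius is tuned to a two-sided bound, which leaves a factor 2 to spare.\<close>
    have "(m * r)\<^sup>2 = ln (2 / \<beta>) / (2 * real K)"
      using ln assms by (simp add: r_def DKW_radius_def)
    then have "exp (- 2 * real K * (m * r)\<^sup>2) = exp (- ln (2 / \<beta>))"
      using \<open>K \<ge> 1\<close> by simp
    also have "\<dots> = \<beta> / 2"
      using \<open>0 < \<beta>\<close> by (simp add: exp_minus)
    finally have "1 - \<beta> \<le> 1 - exp (- 2 * real K * (m * r)\<^sup>2)"
      using \<open>0 < \<beta>\<close> by simp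
    also have "\<dots> \<le> \<P>(R in ?M. \<P>(x in P. x \<le> ?q R + r) \<ge> p)"
      using assms p r lower
      by (intro sample_quantile_upper_confidence[where a = a and b = b and f = "\<lambda>x. ennreal (f x)"] P) auto
    also have "\<dots> \<le> \<P>(R in ?M. \<P>(x in Ptest. x \<le> ?q R + r + \<eta>) \<ge> 1 - \<delta>)"
    proof (rule M.finite_measure_mono)
      show "{R \<in> space ?M. p \<le> \<P>(x in P. x \<le> ?q R + r)}
          \<subseteq> {R \<in> space ?M. 1 - \<delta> \<le> \<P>(x in Ptest. x \<le> ?q R + r + \<eta>)}"
      proof safe
        fix R assume "p \<le> \<P>(x in P. x \<le> ?q R + r)"
        then show "1 - \<delta> \<le> \<P>(x in Ptest. x \<le> ?q R + r + \<eta>)"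
          using LP_transfer[OF P(1) Pid T(1) Tid \<open>LP \<eta> P Ptest \<le> \<rho>\<close>, of "?q R + r"]
          by (simp add: p_def)
      qed
      have [measurable]: "(\<lambda>c. \<P>(x in Ptest. x \<le> c)) \<in> borel_measurable borel"
        by (intro borel_measurable_mono monoI T.finite_measure_mono) auto
      note [measurable] = borel_measurable_sample_quantile[OF Pid \<open>K \<ge> 1\<close> p]
      show "{R \<in> space ?M. 1 - \<delta> \<le> \<P>(x in Ptest. x \<le> ?q R + r + \<eta>)} \<in> sets ?M"
        by measurable
    qed
    finally show ?thesis .
  qed
  have robust: "1 - \<delta> \<le> (INF Q \<in> LP_ball X (r + \<eta>) \<rho> (empirical X K R). \<P>(x in Q. x \<le> ?q R + r + \<eta>))"
    if R: "R \<in> space ?M" for R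
  proof (rule cINF_greatest)
    let ?E = "empirical X K R"
    have "space P = X"
      using sets_eq_imp_space_eq[OF P(2)] by (simp add: space_restrict_space)
    then have RX: "R i \<in> X" if "i \<in> {1..K}" for i
      using R that by (auto simp: space_PiM)
    have E: "?E \<in> borel_probs X"
      using assms RX by (intro empirical_in_borel_probs) auto
    then have Ep: "prob_space ?E" and Eid: "(\<lambda>x. x) \<in> borel_measurable ?E"
      by (auto simp: borel_probs_iff intro: id_borel_measurable)
    have "LP (r + \<eta>) ?E ?E \<le> \<rho>"
      using LP_refl[OF Ep Eid, of "r + \<eta>"] r assms by simp
    then show "LP_ball X (r + \<eta>) \<rho> ?E \<noteq> {}"
      using E by (auto simp: LP_ball_def)
    have "real K * p \<le> (\<Sum>i=1..K. indicator {..?q R} (R i))"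
      using sample_quantile_le_iff[OF \<open>K \<ge> 1\<close> p, of R "?q R"] by simp
    then have mass: "p \<le> \<P>(x in ?E. x \<le> ?q R)"
      using \<open>K \<ge> 1\<close> RX by (subst measure_empirical_atMost) (auto simp: field_simps)
    fix Q assume "Q \<in> LP_ball X (r + \<eta>) \<rho> ?E"
    then have "prob_space Q" "(\<lambda>x. x) \<in> borel_measurable Q" "LP (r + \<eta>) ?E Q \<le> \<rho>"
      by (auto simp: LP_ball_def borel_probs_iff intro: id_borel_measurable)
    from LP_transfer[OF Ep Eid this, of "?q R"] mass
    show "1 - \<delta> \<le> \<P>(x in Q. x \<le> ?q R + r + \<eta>)"
      by (simp add: p_def add.assoc)
  qed
  show ?thesis
    unfolding alpha r_def[symmetric] by (intro conjI ballI sampling robust)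
qed

end
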